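(* There exist a loss function $\ell:\mathbb{R}\to\mathbb{R}$ which is convex, strictly decreasing to $0$ and $2$-smooth, and a linearly separable dataset $\{(\boldsymbol{x}_i,y_i)\}_{i=1}^n$ (with $\boldsymbol{x}_i\in\mathbb{R}^d$, $\|\boldsymbol{x}_i\|\le1$, $y_i\in\{-1,+1\}$), such that $\bar{\boldsymbol{w}}(B)/B$ does not converge as $B\to\infty$, where $\bar{\boldsymbol{w}}(B)=\arg\min_{\|\boldsymbol{w}\|\le B}\frac1n\sum_{i=1}^n\ell(y_i\langle\boldsymbol{w},\boldsymbol{x}_i\rangle)$.
   Context: $\|\cdot\|$ is the Euclidean norm. "$2$-smooth" means differentiable with $2$-Lipschitz derivative. "Strictly decreasing to $0$" means strictly decreasing with $\lim_{z\to\infty}\ell(z)=0$. "Linearly separable" means there exist a unit vector $\boldsymbol{u}$ and $\gamma>0$ with $y_i\langle\boldsymbol{u},\boldsymbol{x}_i\rangle\ge\gamma$ for all $i$. For such data and loss, the minimizer $\bar{\boldsymbol{w}}(B)$ is unique. *)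

theory Defs
  imports "HOL-Analysis.Analysis"
begin

text \<open>
  The dimension \<open>d\<close> is existentially quantified in the theorem, so it cannot be a type parameter.
  Vectors are the points of \<^const>\<open>Euclidean_space\<close> \<open>d\<close>, i.e. the functions
  \<open>w :: nat \<Rightarrow> real\<close> with \<open>w i = 0\<close> for all \<open>i \<ge> d\<close>; its topology is the usual one.
\<close>

definition euc_inner :: "nat \<Rightarrow> (nat \<Rightarrow> real) \<Rightarrow> (nat \<Rightarrow> real) \<Rightarrow> real" where
  "euc_inner d v w = (\<Sum>i<d. v i * w i)"

definition euc_norm :: "nat \<Rightarrow> (nat \<Rightarrow> real) \<Rightarrow> real" where
  "euc_norm d v = L2_set v {..<d}"

definition smooth_loss :: "real \<Rightarrow> (real \<Rightarrow> real) \<Rightarrow> bool" where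
  "smooth_loss L l \<longleftrightarrow> (\<forall>z. l differentiable (at z)) \<and> L-lipschitz_on UNIV (deriv l)"

definition strictly_decreasing_to_0 :: "(real \<Rightarrow> real) \<Rightarrow> bool" where
  "strictly_decreasing_to_0 l \<longleftrightarrow> strict_antimono_on UNIV l \<and> (l \<longlongrightarrow> 0) at_top"

text \<open>A dataset consists of the pairs \<open>(x i, y i)\<close> for \<open>i < n\<close>; values at other indices are irrelevant.\<close>

definition dataset :: "nat \<Rightarrow> nat \<Rightarrow> (nat \<Rightarrow> nat \<Rightarrow> real) \<Rightarrow> (nat \<Rightarrow> real) \<Rightarrow> bool" where
  "dataset d n x y \<longleftrightarrow> n \<ge> 1 \<and>
     (\<forall>i<n. x i \<in> topspace (Euclidean_space d) \<and> euc_norm d (x i) \<le> 1 \<and> y i \<in> {-1, 1})"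

definition linearly_separable :: "nat \<Rightarrow> nat \<Rightarrow> (nat \<Rightarrow> nat \<Rightarrow> real) \<Rightarrow> (nat \<Rightarrow> real) \<Rightarrow> bool" where
  "linearly_separable d n x y \<longleftrightarrow>
     (\<exists>u\<in>topspace (Euclidean_space d). \<exists>\<gamma>>0. euc_norm d u = 1 \<and>
        (\<forall>i<n. y i * euc_inner d u (x i) \<ge> \<gamma>))"

definition empirical_risk ::
  "(real \<Rightarrow> real) \<Rightarrow> nat \<Rightarrow> nat \<Rightarrow> (nat \<Rightarrow> nat \<Rightarrow> real) \<Rightarrow> (nat \<Rightarrow> real) \<Rightarrow> (nat \<Rightarrow> real) \<Rightarrow> real" where
  "empirical_risk l d n x y w = (1 / real n) * (\<Sum>i<n. l (y i * euc_inner d w (x i)))"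

definition euc_ball :: "nat \<Rightarrow> real \<Rightarrow> (nat \<Rightarrow> real) set" where
  "euc_ball d B = {w \<in> topspace (Euclidean_space d). euc_norm d w \<le> B}"

text \<open>
  \<^const>\<open>arg_min\<close> is a choice among minimizers; by \<open>ex1_constrained_minimizer\<close> below there is exactly
  one whenever \<open>B \<ge> 0\<close> and the loss and the data are as in the theorem.
\<close>

definition constrained_minimizer ::
  "(real \<Rightarrow> real) \<Rightarrow> nat \<Rightarrow> nat \<Rightarrow> (nat \<Rightarrow> nat \<Rightarrow> real) \<Rightarrow> (nat \<Rightarrow> real) \<Rightarrow> real \<Rightarrow> nat \<Rightarrow> real" where
  "constrained_minimizer l d n x y B = arg_min (empirical_risk l d n x y) (\<lambda>w. w \<in> euc_ball d B)"

lemma compact_euc_ball: "compact (euc_ball d B)"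
proof -
  have cl: "closed {w :: nat \<Rightarrow> real. \<forall>i\<ge>d. w i = 0}"
    using closedin_Euclidean_space[of d]
    by (simp add: topspace_Euclidean_space euclidean_product_topology)
  have cl2: "closed {w :: nat \<Rightarrow> real. L2_set w {..<d} \<le> B}"
    unfolding L2_set_def by (intro closed_Collect_le continuous_intros) auto
  have eq: "euc_ball d B = {w. \<forall>i\<ge>d. w i = 0} \<inter> {w. L2_set w {..<d} \<le> B}"
    by (auto simp: euc_ball_def euc_norm_def topspace_Euclidean_space)
  have sub: "euc_ball d B \<subseteq> PiE UNIV (\<lambda>_. cball 0 \<bar>B\<bar>)"
  proof
    fix w assume w: "w \<in> euc_ball d B"
    have "\<bar>w i\<bar> \<le> \<bar>B\<bar>" for i
    proof (cases "i < d")
      case True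
      have "\<bar>w i\<bar> \<le> L2_set (\<lambda>i. \<bar>w i\<bar>) {..<d}"
        using True by (intro member_le_L2_set) auto
      also have "\<dots> = L2_set w {..<d}" by (simp add: L2_set_def)
      finally show ?thesis using w by (auto simp: eq)
    next
      case False then show ?thesis using w by (auto simp: eq)
    qed
    then show "w \<in> PiE UNIV (\<lambda>_. cball 0 \<bar>B\<bar>)" by auto
  qed
  have "compact (PiE UNIV (\<lambda>_::nat. cball (0::real) \<bar>B\<bar>))"
    using compactin_PiE[of "\<lambda>_::nat. euclideanreal" UNIV "\<lambda>_. cball 0 \<bar>B\<bar>"]
    by (simp add: euclidean_product_topology)
  moreover have "closed (euc_ball d B)" using cl cl2 eq by auto
  ultimately show ?thesis
    using sub by (metis compact_Int_closed inf.absorb_iff2)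
qed

lemma ex1_constrained_minimizer:
  assumes "convex_on UNIV l" "strictly_decreasing_to_0 l" "smooth_loss L l"
    and "dataset d n x y" "linearly_separable d n x y" "B \<ge> 0"
  shows "\<exists>!w. is_arg_min (empirical_risk l d n x y) (\<lambda>w. w \<in> euc_ball d B) w"
proof -
  let ?R = "empirical_risk l d n x y"
  have n: "n \<ge> 1" using assms(4) by (simp add: dataset_def)
  have cl: "continuous_on UNIV l"
    using assms(3) by (auto simp: smooth_loss_def intro!: continuous_at_imp_continuous_on differentiable_imp_continuous_within)
  have cR: "continuous_on S ?R" for S
    unfolding empirical_risk_def euc_inner_def
    by (intro continuous_intros continuous_on_compose2[OF cl]) (auto intro: continuous_on_product_then_coordinatewise)
  have zero: "(\<lambda>_. 0) \<in> euc_ball d B"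
    using assms(6) by (simp add: euc_ball_def topspace_Euclidean_space euc_norm_def L2_set_def)
  obtain w0 where w0: "w0 \<in> euc_ball d B" "\<forall>w\<in>euc_ball d B. ?R w0 \<le> ?R w"
    using continuous_attains_inf[OF compact_euc_ball _ cR] zero by blast
  obtain u \<gamma> where u: "u \<in> topspace (Euclidean_space d)" "\<gamma> > 0" "euc_norm d u = 1"
    "\<And>i. i < n \<Longrightarrow> y i * euc_inner d u (x i) \<ge> \<gamma>"
    using assms(5) by (auto simp: linearly_separable_def)
  have uniq: "w1 = w2" if w1: "w1 \<in> euc_ball d B" "\<forall>w\<in>euc_ball d B. ?R w1 \<le> ?R w"
    and w2: "w2 \<in> euc_ball d B" "\<forall>w\<in>euc_ball d B. ?R w2 \<le> ?R w" for w1 w2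
  proof (rule ccontr)
    assume ne: "w1 \<noteq> w2"
    define m where "m = (\<lambda>i. (w1 i + w2 i) / 2)"
    have out: "w1 i = 0" "w2 i = 0" "u i = 0" if "i \<ge> d" for i
      using w1(1) w2(1) u(1) that by (simp_all add: euc_ball_def topspace_Euclidean_space)
    obtain k where k: "w1 k \<noteq> w2 k" using ne by auto
    have kd: "k < d" using k out by (metis not_le)
    have sq: "(\<Sum>i<d. (w i)\<^sup>2) \<le> B\<^sup>2" if "w \<in> euc_ball d B" for w
      using that assms(6) unfolding euc_ball_def euc_norm_def L2_set_def
      by (simp add: sqrt_le_D)
    have pos: "0 < (\<Sum>i<d. ((w1 i - w2 i)/2)\<^sup>2)"
      by (rule sum_pos2[of _ k]) (use kd k in auto)
    have "(\<Sum>i<d. (m i)\<^sup>2) = (\<Sum>i<d. ((w1 i)\<^sup>2 / 2 + (w2 i)\<^sup>2 / 2) - ((w1 i - w2 i)/2)\<^sup>2)"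
      unfolding m_def by (intro sum.cong refl) (simp add: power2_eq_square field_simps)
    also have "\<dots> = (\<Sum>i<d. (w1 i)\<^sup>2)/2 + (\<Sum>i<d. (w2 i)\<^sup>2)/2 - (\<Sum>i<d. ((w1 i - w2 i)/2)\<^sup>2)"
      by (simp add: sum.distrib sum_subtractf sum_divide_distrib)
    also have "\<dots> < B\<^sup>2" using sq[OF w1(1)] sq[OF w2(1)] pos by linarith
    finally have mB: "euc_norm d m < B"
      unfolding euc_norm_def L2_set_def using assms(6) real_less_lsqrt by blast
    define e where "e = B - euc_norm d m"
    have e: "e > 0" using mB by (simp add: e_def)
    define v where "v = (\<lambda>i. m i + e * u i)"
    have "euc_norm d v \<le> euc_norm d m + L2_set (\<lambda>i. e * u i) {..<d}"
      unfolding v_def euc_norm_def by (rule L2_set_triangle_ineq)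
    also have "L2_set (\<lambda>i. e * u i) {..<d} = e * euc_norm d u"
      using e L2_set_right_distrib[of e u "{..<d}"] by (simp add: euc_norm_def)
    finally have "euc_norm d v \<le> B" using u(3) by (simp add: e_def)
    moreover have "v i = 0" if "i \<ge> d" for i using out[OF that] by (simp add: v_def m_def)
    ultimately have v: "v \<in> euc_ball d B" by (simp add: euc_ball_def topspace_Euclidean_space)
    have lt: "l (y i * euc_inner d v (x i)) <
        (l (y i * euc_inner d w1 (x i)) + l (y i * euc_inner d w2 (x i))) / 2" if i: "i < n" for i
    proof -
      let ?a = "y i * euc_inner d w1 (x i)" and ?b = "y i * euc_inner d w2 (x i)"
      have "y i * euc_inner d v (x i) = (?a + ?b)/2 + e * (y i * euc_inner d u (x i))"
        by (simp add: euc_inner_def v_def m_def sum_distrib_left sum.distrib sum_divide_distrib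
            algebra_simps add_divide_distrib)
      moreover have "e * (y i * euc_inner d u (x i)) > 0"
        using e u(2) u(4)[OF i] by (metis mult_pos_pos less_le_trans)
      ultimately have "(?a + ?b)/2 < y i * euc_inner d v (x i)" by linarith
      then have "l (y i * euc_inner d v (x i)) < l ((?a + ?b)/2)"
        using assms(2) unfolding strictly_decreasing_to_0_def monotone_on_def by blast
      also have "\<dots> \<le> (l ?a + l ?b)/2"
        using convex_onD[OF assms(1), of "1/2" ?a ?b] by (simp add: field_simps)
      finally show ?thesis .
    qed
    have "(\<Sum>i<n. l (y i * euc_inner d v (x i))) <
        (\<Sum>i<n. (l (y i * euc_inner d w1 (x i)) + l (y i * euc_inner d w2 (x i))) / 2)"
      by (rule sum_strict_mono) (use n lt in \<open>auto simp: lessThan_empty_iff\<close>)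
    then have "?R v < (?R w1 + ?R w2)/2"
      unfolding empirical_risk_def using n
      by (simp add: sum.distrib sum_divide_distrib[symmetric] field_simps)
    moreover have "?R w1 \<le> ?R v" using w1(2) v by blast
    moreover have "?R w2 \<le> ?R v" using w2(2) v by blast
    ultimately show False by argo
  qed
  show ?thesis
    unfolding is_arg_min_linorder using w0 uniq by blast
qed

end

theory Submission
  imports Defs
begin

text \<open>
  The loss is \<open>(2 + sin (ln z)) / (4 z)\<close> for \<open>z \<ge> 1\<close>, continued linearly to the left; the data are
  \<open>e\<^sub>1\<close> and \<open>e\<^sub>2 / 2\<close>, both with label \<open>1\<close>. A minimizer \<open>(a, b)\<close> lies on the circle of radius \<open>B\<close>, and
  being stationary there means \<open>b\<^sup>3 p (ln a) = 2 a\<^sup>3 p (ln (b / 2))\<close> with \<open>p t = 2 + sin t - cos t\<close>.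
  If \<open>(a, b) / B\<close> converged, then \<open>\<rho> = lim b / a\<close> would satisfy
  \<open>\<rho>\<^sup>3 p t = 2 p (t + ln (\<rho> / 2))\<close> for every phase \<open>t\<close>, because \<open>B\<close> can run to infinity with
  \<open>ln B\<close> fixed modulo \<open>2 \<pi>\<close>. Averaging \<open>t\<close> and \<open>t + \<pi>\<close> gives \<open>\<rho>\<^sup>3 = 2\<close>, so \<open>ln (\<rho> / 2)\<close> is a period of
  \<open>p\<close>; but it lies strictly between \<open>- \<pi>\<close> and \<open>0\<close>.
\<close>

section \<open>The oscillating loss: decay, convexity and smoothness\<close>

definition osc_profile :: "real \<Rightarrow> real" where
  "osc_profile t = 2 + sin t - cos t"

text \<open>The linear branch is the tangent of the other branch at 1: both have value
  \<open>1/2\<close> and slope \<open>-1/4\<close> there.\<close>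

definition osc_loss :: "real \<Rightarrow> real" where
  "osc_loss z = (if z \<le> 1 then (3 - z) / 4 else (2 + sin (ln z)) / (4 * z))"

text \<open>Minus the derivative of \<open>osc_loss\<close>. Clamping by \<open>max 1 z\<close> lets
  one formula cover the linear branch too, since \<open>osc_profile 0 / 4 = 1 / 4\<close>.\<close>

definition osc_slope :: "real \<Rightarrow> real" where
  "osc_slope z = osc_profile (ln (max 1 z)) / (4 * (max 1 z)\<^sup>2)"

lemma osc_profile_pos: "osc_profile t > 0"
proof (rule ccontr)
  assume "\<not> osc_profile t > 0"
  then have "sin t = -1" "cos t = 1"
    using sin_ge_minus_one[of t] cos_le_one[of t] unfolding osc_profile_def by linarith+
  then show False using sin_cos_squared_add[of t] by simp
qed

lemma osc_slope_pos: "osc_slope z > 0"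
  unfolding osc_slope_def by (intro divide_pos_pos osc_profile_pos) auto

lemma osc_slope_ge_1: "z \<ge> 1 \<Longrightarrow> osc_slope z = osc_profile (ln z) / (4 * z\<^sup>2)"
  by (simp add: osc_slope_def)

lemma has_real_derivative_osc_loss: "(osc_loss has_real_derivative - osc_slope z) (at z)"
proof -
  let ?S = "{..1::real}" and ?T = "{1..} :: real set"
  have cl: "closure ?S \<inter> closure ?T = {1}" by auto
  have f: "((\<lambda>z. (3 - z) / 4) has_vector_derivative (- 1 / 4)) (at z within ?S)"
    by (auto simp flip: has_real_derivative_iff_has_vector_derivative intro!: derivative_eq_intros)
  have g: "((\<lambda>z. (2 + sin (ln z)) / (4 * z)) has_vector_derivative - osc_slope z) (at z within ?T)"
    if "z \<ge> 1"
    using that unfolding osc_slope_ge_1[OF that]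
    by (auto simp flip: has_real_derivative_iff_has_vector_derivative intro!: derivative_eq_intros
        simp: osc_profile_def power2_eq_square field_simps)
  have "((\<lambda>z. if z \<in> ?S then (3 - z) / 4 else (2 + sin (ln z)) / (4 * z)) has_vector_derivative
      (if z \<in> ?S then - 1 / 4 else - osc_slope z)) (at z within UNIV)"
  proof (rule has_vector_derivative_If_within_closures[where T = ?T])
    show "((\<lambda>z. (3 - z) / 4) has_vector_derivative (- 1 / 4))
        (at z within ?S \<union> closure ?S \<inter> closure ?T)" unfolding cl using f by (simp add: insert_absorb)
    show "((\<lambda>z. (2 + sin (ln z)) / (4 * z)) has_vector_derivative - osc_slope z)
        (at z within ?T \<union> closure ?S \<inter> closure ?T)"
      if "z \<in> ?T \<union> closure ?S \<inter> closure ?T"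
      unfolding cl using that g by (auto simp add: insert_absorb)
  qed (auto simp: osc_slope_def osc_profile_def max_def)
  moreover have "(if z \<in> ?S then - 1 / 4 else - osc_slope z) = - osc_slope z"
    by (auto simp: osc_slope_def osc_profile_def max_def)
  ultimately show ?thesis
    by (simp add: osc_loss_def[abs_def] has_real_derivative_iff_has_vector_derivative)
qed

lemma deriv_osc_loss: "deriv osc_loss = (\<lambda>z. - osc_slope z)"
  using has_real_derivative_osc_loss DERIV_imp_deriv by blast

text \<open>With \<open>p = osc_profile\<close>, the numerator is \<open>p' - 2 p\<close> at
  \<open>ln z\<close> and lies in \<open>[-8, 0]\<close>. The upper bound yields convexity; the
  lower one, over the denominator 4, yields the smoothness constant 2.\<close>

lemma osc_slope_tail_deriv:
  assumes "z \<ge> 1"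
  obtains D where "((\<lambda>z. osc_profile (ln z) / (4 * z\<^sup>2)) has_real_derivative D) (at z)"
    "- 2 \<le> D" "D \<le> 0"
proof
  let ?N = "3 * cos (ln z) - sin (ln z) - 4"
  show "((\<lambda>z. osc_profile (ln z) / (4 * z\<^sup>2)) has_real_derivative ?N / (4 * z ^ 3)) (at z)"
    using assms unfolding osc_profile_def
    by (auto intro!: derivative_eq_intros simp: power2_eq_square power3_eq_cube field_simps)
  have N: "- 8 \<le> ?N" "?N \<le> 0"
    using sin_le_one[of "ln z"] sin_ge_minus_one[of "ln z"] cos_le_one[of "ln z"]
      cos_ge_minus_one[of "ln z"] by linarith+
  have z3: "z ^ 3 \<ge> 1" using assms by simp
  then have "4 * (z ^ 3 * 2) \<ge> 8" by linarith
  with N z3 show "- 2 \<le> ?N / (4 * z ^ 3)" by (subst pos_le_divide_eq) linarith+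
  show "?N / (4 * z ^ 3) \<le> 0" using N assms by (intro divide_nonpos_nonneg) auto
qed

lemma osc_slope_antimono: "a \<le> b \<Longrightarrow> osc_slope b \<le> osc_slope a"
  unfolding osc_slope_def
  by (rule DERIV_nonpos_imp_nonincreasing[where f = "\<lambda>z. osc_profile (ln z) / (4 * z\<^sup>2)"],
      simp, metis osc_slope_tail_deriv max.cobounded1 order_trans)

lemma lipschitz_osc_slope: "2-lipschitz_on UNIV osc_slope"
proof (rule lipschitz_onI)
  fix a b :: real
  let ?f = "\<lambda>z::real. osc_profile (ln z) / (4 * z\<^sup>2)"
  have "\<forall>z\<in>{1..}. \<exists>D. (?f has_real_derivative D) (at z within {1..}) \<and> norm D \<le> 2"
  proof
    fix z :: real assume "z \<in> {1..}"
    then obtain D where "(?f has_real_derivative D) (at z)" "- 2 \<le> D" "D \<le> 0"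
      using osc_slope_tail_deriv[of z] by auto
    then show "\<exists>D. (?f has_real_derivative D) (at z within {1..}) \<and> norm D \<le> 2"
      by (intro exI[of _ D]) (auto intro: has_field_derivative_at_within)
  qed
  then obtain D where D: "\<And>z. z \<in> {1..} \<Longrightarrow> (?f has_real_derivative D z) (at z within {1..})"
    "\<And>z. z \<in> {1..} \<Longrightarrow> norm (D z) \<le> 2" by metis
  \<comment> \<open>The clamp maps into \<open>{1..}\<close> and is 1-Lipschitz, so the bound on the
    tail suffices.\<close>
  have "norm (?f (max 1 a) - ?f (max 1 b)) \<le> 2 * norm (max 1 a - max 1 b)"
    by (rule field_differentiable_bound[of "{1..}" ?f D]) (use D in auto)
  also have "\<dots> \<le> 2 * norm (a - b)" by (simp add: max_def)
  finally show "dist (osc_slope a) (osc_slope b) \<le> 2 * dist a b"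
    by (simp add: osc_slope_def dist_norm)
qed simp

lemma osc_loss_strict_antimono: "a < b \<Longrightarrow> osc_loss b < osc_loss a"
  by (rule DERIV_neg_imp_decreasing) (use has_real_derivative_osc_loss osc_slope_pos in force)+

lemma osc_loss_tendsto_0: "(osc_loss \<longlongrightarrow> 0) at_top"
proof (rule Lim_null_comparison)
  show "\<forall>\<^sub>F z in at_top. norm (osc_loss z) \<le> inverse z"
    using eventually_gt_at_top[of 1]
  proof eventually_elim
    case (elim z)
    have "\<bar>2 + sin (ln z)\<bar> \<le> 4"
      using sin_le_one[of "ln z"] sin_ge_minus_one[of "ln z"] by linarith
    then show ?case using elim by (simp add: osc_loss_def abs_mult field_simps)
  qed
  show "(inverse \<longlongrightarrow> (0::real)) at_top" by (rule tendsto_inverse_0_at_top) (rule filterlim_ident)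
qed

lemma osc_loss_convex: "convex_on UNIV osc_loss"
  by (rule convex_on_realI[OF _ has_real_derivative_osc_loss])
    (auto intro: osc_slope_antimono)

lemma osc_loss_decreasing: "strictly_decreasing_to_0 osc_loss"
  by (simp add: strictly_decreasing_to_0_def monotone_on_def osc_loss_strict_antimono osc_loss_tendsto_0)

lemma osc_loss_smooth: "smooth_loss 2 osc_loss"
  using lipschitz_osc_slope has_real_derivative_osc_loss unfolding smooth_loss_def deriv_osc_loss
  by (auto simp: lipschitz_on_def dist_minus real_differentiable_def)

section \<open>The two-point dataset\<close>

text \<open>With two unit vectors the risk would be symmetric and its unique minimizer would stay on
  the diagonal. Halving the second vector breaks the symmetry and puts the two margins out of
  phase.\<close>

definition axis_data :: "nat \<Rightarrow> nat \<Rightarrow> real" where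
  "axis_data i j = (if i = j then if i = 0 then 1 else if i = 1 then 1 / 2 else 0 else 0)"

lemma axis_dataset: "dataset 2 2 axis_data (\<lambda>_. 1)"
  by (auto simp: dataset_def topspace_Euclidean_space axis_data_def euc_norm_def L2_set_def
      less_Suc_eq lessThan_Suc numeral_2_eq_2 real_sqrt_le_iff power2_eq_square)

lemma axis_separable: "linearly_separable 2 2 axis_data (\<lambda>_. 1)"
proof -
  \<comment> \<open>A unit vector with margins \<open>3/5\<close> and \<open>(4/5)/2 = 2/5\<close>;
    the smaller one is the separation constant.\<close>
  define u :: "nat \<Rightarrow> real" where "u i = (if i = 0 then 3/5 else if i = 1 then 4/5 else 0)" for i
  show ?thesis unfolding linearly_separable_def
  proof (intro bexI exI conjI)
    show "u \<in> topspace (Euclidean_space 2)" by (auto simp: u_def topspace_Euclidean_space)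
    show "(2/5 :: real) > 0" by simp
    show "euc_norm 2 u = 1"
      by (simp add: u_def euc_norm_def L2_set_def numeral_2_eq_2 power2_eq_square)
    show "\<forall>i<2. 1 * euc_inner 2 u (axis_data i) \<ge> 2/5"
      by (auto simp: u_def euc_inner_def axis_data_def less_Suc_eq numeral_2_eq_2)
  qed
qed

section \<open>Minimizers over the disc: stationarity and ratio bounds\<close>

lemma axis_risk:
  "empirical_risk l 2 2 axis_data (\<lambda>_. 1) w = (l (w 0) + l (w 1 / 2)) / 2"
  by (simp add: empirical_risk_def euc_inner_def axis_data_def numeral_2_eq_2)

lemma mem_euc_ball_2:
  assumes "B \<ge> 0"
  shows "w \<in> euc_ball 2 B \<longleftrightarrow> (\<forall>i\<ge>2. w i = 0) \<and> (w 0)\<^sup>2 + (w 1)\<^sup>2 \<le> B\<^sup>2"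
proof -
  have "sqrt ((w 0)\<^sup>2 + (w 1)\<^sup>2) \<le> B \<longleftrightarrow> (w 0)\<^sup>2 + (w 1)\<^sup>2 \<le> B\<^sup>2"
    using assms by (meson real_le_lsqrt sqrt_le_D sum_power2_ge_zero)
  then show ?thesis
    by (simp add: euc_ball_def topspace_Euclidean_space euc_norm_def L2_set_def numeral_2_eq_2)
qed

text \<open>Raising \<open>a\<close> to \<open>sqrt (B^2 - b^2)\<close> stays in the disc and would
  lower the objective if it changed \<open>a\<close>; so \<open>a\<close> already is that root.
  Likewise for \<open>b\<close>.\<close>

lemma disc_minimizer_on_circle:
  fixes l :: "real \<Rightarrow> real"
  assumes dec: "\<And>s t. s < t \<Longrightarrow> l t < l s"
    and in_disc: "a\<^sup>2 + b\<^sup>2 \<le> B\<^sup>2"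
    and min: "\<And>a' b'. a'\<^sup>2 + b'\<^sup>2 \<le> B\<^sup>2 \<Longrightarrow> l a + l (b / 2) \<le> l a' + l (b' / 2)"
  shows "a \<ge> 0" "b \<ge> 0" "a\<^sup>2 + b\<^sup>2 = B\<^sup>2"
proof -
  define a' b' where "a' = sqrt (B\<^sup>2 - b\<^sup>2)" and "b' = sqrt (B\<^sup>2 - a\<^sup>2)"
  have sq: "a'\<^sup>2 = B\<^sup>2 - b\<^sup>2" "b'\<^sup>2 = B\<^sup>2 - a\<^sup>2"
    unfolding a'_def b'_def
    by (rule real_sqrt_pow2; use in_disc zero_le_power2[of a] zero_le_power2[of b] in linarith)+
  have nonneg: "a' \<ge> 0" "b' \<ge> 0"
    unfolding a'_def b'_def
    by (rule real_sqrt_ge_zero; use in_disc zero_le_power2[of a] zero_le_power2[of b] in linarith)+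
  have ge: "a \<le> a'" "b \<le> b'"
    unfolding a'_def b'_def by (rule real_le_rsqrt; use in_disc in linarith)+
  have "a = a'" using ge(1) dec[of a a'] min[of a' b] sq(1) by force
  then show "a \<ge> 0" "a\<^sup>2 + b\<^sup>2 = B\<^sup>2" using sq(1) nonneg(1) by simp_all
  have "b = b'" using ge(2) dec[of "b / 2" "b' / 2"] min[of a b'] sq(2) by force
  then show "b \<ge> 0" using nonneg(2) by simp
qed

text \<open>The derivative along the angle vanishes at the minimum: the Lagrange condition with its
  multiplier eliminated.\<close>

lemma circle_stationary:
  fixes l g :: "real \<Rightarrow> real"
  assumes der: "\<And>z. (l has_real_derivative - g z) (at z)"
    and circle: "a\<^sup>2 + b\<^sup>2 = B\<^sup>2" and B: "B > 0"
    and min: "\<And>a' b'. a'\<^sup>2 + b'\<^sup>2 = B\<^sup>2 \<Longrightarrow> l a + l (b / 2) \<le> l a' + l (b' / 2)"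
  shows "2 * b * g a = a * g (b / 2)"
proof -
  have "(a / B)\<^sup>2 + (b / B)\<^sup>2 = 1"
    using circle B by (simp add: power_divide flip: add_divide_distrib)
  then obtain \<theta> where "a / B = cos \<theta>" "b / B = sin \<theta>" by (rule sincos_total_2pi)
  with B have ab: "a = B * cos \<theta>" "b = B * sin \<theta>" by (simp_all add: field_simps)
  let ?f = "\<lambda>t. l (B * cos t) + l (B * sin t / 2)"
  have "(?f has_real_derivative b * g a - a * g (b / 2) / 2) (at \<theta>)"
    unfolding ab by (auto intro!: derivative_eq_intros DERIV_chain2[OF der])
  moreover have "?f \<theta> \<le> ?f t" for t
    using min[of "B * cos t" "B * sin t"]
    by (simp add: ab power_mult_distrib flip: distrib_left)
  ultimately have "b * g a - a * g (b / 2) / 2 = 0"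
    by (intro DERIV_local_min[of ?f _ \<theta> 1]) auto
  then show ?thesis by simp
qed

text \<open>If \<open>b / 2 > a\<close>, monotonicity of \<open>g\<close> turns stationarity into
  \<open>2 * b \<le> a\<close>, which is absurd. Hence \<open>b / 2 \<le> a\<close>, and
  monotonicity then gives \<open>a \<le> 2 * b\<close>. Both coordinates are thus of order
  \<open>B\<close>.\<close>

lemma stationary_ratio_bounds:
  fixes g :: "real \<Rightarrow> real"
  assumes mono: "\<And>s t. s \<le> t \<Longrightarrow> g t \<le> g s" and pos: "\<And>z. g z > 0"
    and st: "2 * b * g a = a * g (b / 2)" and nonneg: "a \<ge> 0" "b \<ge> 0"
  shows "a \<le> 2 * b" "b \<le> 2 * a"
proof -
  show b: "b \<le> 2 * a"
  proof (rule ccontr)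
    assume "\<not> b \<le> 2 * a"
    then have lt: "2 * a < b" by simp
    then have "a * g (b / 2) \<le> a * g a" using nonneg by (intro mult_left_mono mono) auto
    with st have "(2 * b) * g a \<le> a * g a" by simp
    then show False using pos[of a] lt nonneg by simp
  qed
  then have "a * g a \<le> a * g (b / 2)" using nonneg by (intro mult_left_mono mono) auto
  with st have "a * g a \<le> (2 * b) * g a" by simp
  then show "a \<le> 2 * b" using pos[of a] by simp
qed

lemma osc_minimizer:
  defines "W \<equiv> constrained_minimizer osc_loss 2 2 axis_data (\<lambda>_. 1)"
  assumes B: "B > 0"
  shows "W B 0 \<ge> 0" "W B 1 \<ge> 0" "(W B 0)\<^sup>2 + (W B 1)\<^sup>2 = B\<^sup>2"
    "2 * W B 1 * osc_slope (W B 0) = W B 0 * osc_slope (W B 1 / 2)"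
proof -
  let ?R = "empirical_risk osc_loss 2 2 axis_data (\<lambda>_. 1)"
  \<comment> \<open>\<open>arg_min\<close> is a choice, so existence of a minimizer has to be
    supplied.\<close>
  have "is_arg_min ?R (\<lambda>w. w \<in> euc_ball 2 B) (W B)"
    using ex1_constrained_minimizer[OF osc_loss_convex osc_loss_decreasing osc_loss_smooth
        axis_dataset axis_separable, of B] B
    unfolding W_def constrained_minimizer_def arg_min_def by (metis less_imp_le someI_ex)
  then have mem: "W B \<in> euc_ball 2 B" and le: "\<And>v. v \<in> euc_ball 2 B \<Longrightarrow> ?R (W B) \<le> ?R v"
    by (auto simp: is_arg_min_linorder)
  have disc: "(W B 0)\<^sup>2 + (W B 1)\<^sup>2 \<le> B\<^sup>2" using mem B by (simp add: mem_euc_ball_2)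
  have min: "osc_loss (W B 0) + osc_loss (W B 1 / 2) \<le> osc_loss a + osc_loss (b / 2)"
    if "a\<^sup>2 + b\<^sup>2 \<le> B\<^sup>2" for a b
    using le[of "(\<lambda>_. 0)(0 := a, 1 := b)"] that B by (simp add: mem_euc_ball_2 axis_risk)
  note circ = disc_minimizer_on_circle[OF osc_loss_strict_antimono disc min]
  then show "W B 0 \<ge> 0" "W B 1 \<ge> 0" "(W B 0)\<^sup>2 + (W B 1)\<^sup>2 = B\<^sup>2" by blast+
  show "2 * W B 1 * osc_slope (W B 0) = W B 0 * osc_slope (W B 1 / 2)"
    by (rule circle_stationary[OF has_real_derivative_osc_loss _ B min])
      (use circ in auto)
qed

section \<open>The limiting phase equation and its contradiction\<close>

lemma osc_profile_shift_rigid: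
  assumes shift: "\<And>t. \<rho> ^ 3 * osc_profile t = 2 * osc_profile (t + ln (\<rho> / 2))"
    and \<rho>: "1 / 2 \<le> \<rho>"
  shows False
proof -
  define c where "c = ln (\<rho> / 2)"
  \<comment> \<open>Values of the profile half a period apart sum to 4, so the oscillation
    cancels.\<close>
  have "\<rho> ^ 3 * (osc_profile 0 + osc_profile pi) = 2 * (osc_profile c + osc_profile (c + pi))"
    using shift[of 0] shift[of pi] by (simp add: distrib_left c_def add.commute)
  then have r3: "\<rho> ^ 3 = 2" by (simp add: osc_profile_def)
  have "sin c - cos c = -1" using shift[of 0] r3 by (simp add: osc_profile_def c_def)
  moreover have "cos c + sin c = 1"
    using shift[of "pi / 2"] r3
    by (simp add: osc_profile_def c_def sin_add cos_add)
  ultimately have s: "sin c = 0" by linarith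
  have "\<rho> < 2"
  proof (rule ccontr)
    assume "\<not> \<rho> < 2"
    then have "2 ^ 3 \<le> \<rho> ^ 3" by (intro power_mono) auto
    with r3 show False by simp
  qed
  then have "c < 0" using \<rho> by (simp add: c_def)
  \<comment> \<open>The bound \<open>1 / 2 \<le> \<rho>\<close> keeps \<open>c\<close> within half a
    period of 0, where sine has no other zero.\<close>
  moreover have "- c < pi"
  proof -
    have "- c = ln (2 / \<rho>)" using \<rho> by (simp add: c_def ln_div)
    also have "\<dots> \<le> 2 / \<rho> - 1" using \<rho> by (intro ln_le_minus_one) auto
    also have "\<dots> \<le> 3" using \<rho> by (simp add: field_simps)
    also have "\<dots> < pi" by (rule pi_gt3)
    finally show ?thesis .
  qed
  ultimately have "sin (- c) > 0" by (intro sin_gt_zero) auto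
  with s show False by simp
qed

lemma osc_direction_diverges:
  fixes a b :: "real \<Rightarrow> real"
  assumes nonneg: "\<And>B. B > 0 \<Longrightarrow> a B \<ge> 0 \<and> b B \<ge> 0"
    and circle: "\<And>B. B > 0 \<Longrightarrow> (a B)\<^sup>2 + (b B)\<^sup>2 = B\<^sup>2"
    and st: "\<And>B. B > 0 \<Longrightarrow> 2 * b B * osc_slope (a B) = a B * osc_slope (b B / 2)"
    and lima: "((\<lambda>B. a B / B) \<longlongrightarrow> \<alpha>) at_top" and limb: "((\<lambda>B. b B / B) \<longlongrightarrow> \<beta>) at_top"
  shows False
proof -
  have ratio: "a B \<le> 2 * b B" "b B \<le> 2 * a B" if "B > 0" for B
    using stationary_ratio_bounds[OF osc_slope_antimono osc_slope_pos st] nonneg that by blast+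
  \<comment> \<open>\<open>b \<le> 2 * a\<close> gives \<open>B^2 \<le> 5 * a^2\<close>; 9 replaces
    5 as the next square.\<close>
  have a_ge: "a B / B \<ge> 1 / 3" if "B > 0" for B
  proof -
    have "(b B)\<^sup>2 \<le> (2 * a B)\<^sup>2" using ratio nonneg that by (intro power_mono) auto
    then have "(b B)\<^sup>2 \<le> 4 * (a B)\<^sup>2" by (simp add: power_mult_distrib)
    then have "B\<^sup>2 \<le> 9 * (a B)\<^sup>2"
      using circle[OF that] zero_le_power2[of "a B"] by linarith
    then have "B\<^sup>2 \<le> (3 * a B)\<^sup>2" by (simp add: power_mult_distrib)
    then have "B \<le> 3 * a B" by (rule power2_le_imp_le) (use nonneg[OF that] in simp)
    then show ?thesis using that by (simp add: field_simps)
  qed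
  have \<alpha>: "\<alpha> \<ge> 1 / 3"
    by (rule tendsto_lowerbound[OF lima eventually_mono[OF eventually_gt_at_top[of 0]]])
      (use a_ge in auto)
  have "((\<lambda>B. 2 * (b B / B) - a B / B) \<longlongrightarrow> 2 * \<beta> - \<alpha>) at_top"
    by (intro tendsto_intros lima limb)
  then have "0 \<le> 2 * \<beta> - \<alpha>"
    by (rule tendsto_lowerbound[OF _ eventually_mono[OF eventually_gt_at_top[of 0]]])
      (use ratio in \<open>auto simp: divide_right_mono simp flip: diff_divide_distrib\<close>)
  then have \<beta>: "\<beta> \<ge> \<alpha> / 2" by simp
  \<comment> \<open>For \<open>B \<ge> 12\<close> one has \<open>a \<ge> 4\<close> and
    \<open>b / 2 \<ge> 1\<close>, so both slopes are on the oscillating branch. Splitting off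
    \<open>ln B\<close> isolates the only nonconvergent quantity.\<close>
  have balance: "(b B / B) ^ 3 * osc_profile (ln (a B / B) + ln B) =
      2 * (a B / B) ^ 3 * osc_profile (ln (b B / B / 2) + ln B)" if "B \<ge> 12" for B
  proof -
    have B: "B > 0" using that by simp
    have a: "a B \<ge> 4" using a_ge[OF B] that by (simp add: field_simps)
    with ratio[OF B] have b: "b B \<ge> 2" by simp
    have eq: "2 * b B * (osc_profile (ln (a B)) / (4 * (a B)\<^sup>2)) =
        a B * (osc_profile (ln (b B / 2)) / (4 * (b B / 2)\<^sup>2))"
      using st[OF B] a b by (simp add: osc_slope_ge_1)
    then have "b B ^ 3 * osc_profile (ln (a B)) = 2 * a B ^ 3 * osc_profile (ln (b B / 2))"
      using a b by (simp add: field_simps power2_eq_square power3_eq_cube)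
    moreover have "ln (a B / B) + ln B = ln (a B)" "ln (b B / B / 2) + ln B = ln (b B / 2)"
      using a b B by (simp_all add: ln_div ln_mult)
    ultimately show ?thesis by (simp add: power_divide)
  qed
  have limit_eq: "\<beta> ^ 3 * osc_profile (ln \<alpha> + \<phi>) = 2 * \<alpha> ^ 3 * osc_profile (ln (\<beta> / 2) + \<phi>)" for \<phi>
  proof -
    \<comment> \<open>These radii tend to infinity while their logarithms stay equal to \<phi>
      modulo \<open>2 * pi\<close>.\<close>
    define s where "s k = exp (\<phi> + 2 * pi * real k)" for k :: nat
    have "filterlim (\<lambda>k. \<phi> + 2 * pi * real k) at_top sequentially"
      by (intro filterlim_tendsto_add_at_top[OF tendsto_const]
          filterlim_tendsto_pos_mult_at_top[OF tendsto_const] filterlim_real_sequentially) simp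
    then have s: "filterlim s at_top sequentially"
      unfolding s_def by (rule filterlim_compose[OF exp_at_top])
    have per: "osc_profile (t + ln (s k)) = osc_profile (t + \<phi>)" for t k
    proof -
      have "t + ln (s k) = (t + \<phi>) + 2 * real k * pi" by (simp add: s_def)
      then show ?thesis
        unfolding osc_profile_def
        by (simp only: sin_add[of "t + \<phi>"] cos_add[of "t + \<phi>"] sin_2npi cos_2npi)
    qed
    note la = filterlim_compose[OF lima s] and lb = filterlim_compose[OF limb s]
    have lhs: "(\<lambda>k. (b (s k) / s k) ^ 3 * osc_profile (ln (a (s k) / s k) + \<phi>))
        \<longlonglongrightarrow> \<beta> ^ 3 * osc_profile (ln \<alpha> + \<phi>)"
      \<comment> \<open>Positivity of the limit makes \<open>ln\<close> continuous there.\<close>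
      unfolding osc_profile_def by (intro tendsto_intros la lb) (use \<alpha> in auto)
    have rhs: "(\<lambda>k. 2 * (a (s k) / s k) ^ 3 * osc_profile (ln (b (s k) / s k / 2) + \<phi>))
        \<longlonglongrightarrow> 2 * \<alpha> ^ 3 * osc_profile (ln (\<beta> / 2) + \<phi>)"
      unfolding osc_profile_def by (intro tendsto_intros la lb) (use \<alpha> \<beta> in auto)
    have "\<forall>\<^sub>F k in sequentially. 2 * (a (s k) / s k) ^ 3 * osc_profile (ln (b (s k) / s k / 2) + \<phi>) =
        (b (s k) / s k) ^ 3 * osc_profile (ln (a (s k) / s k) + \<phi>)"
      using filterlim_at_top[THEN iffD1, OF s, rule_format, of 12]
      by eventually_elim (use balance per in metis)
    from LIMSEQ_unique[OF lhs Lim_transform_eventually[OF rhs this]] show ?thesis .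
  qed
  show False
  proof (rule osc_profile_shift_rigid[of "\<beta> / \<alpha>"])
    show "1 / 2 \<le> \<beta> / \<alpha>" using \<alpha> \<beta> by (simp add: field_simps)
    fix t
    \<comment> \<open>Taking the phase \<open>t - ln \<alpha>\<close> leaves only the ratio of the
      limits in the equation.\<close>
    have "t - ln \<alpha> + ln (\<beta> / 2) = t + ln (\<beta> / \<alpha> / 2)"
      using \<alpha> \<beta> by (simp add: ln_div ln_mult)
    with limit_eq[of "t - ln \<alpha>"] \<alpha>
    show "(\<beta> / \<alpha>) ^ 3 * osc_profile t = 2 * osc_profile (t + ln (\<beta> / \<alpha> / 2))"
      by (simp add: power_divide field_simps)
  qed
qed

theorem proposition13:
  shows "\<exists>(l :: real \<Rightarrow> real) (d :: nat) (n :: nat) (x :: nat \<Rightarrow> nat \<Rightarrow> real) (y :: nat \<Rightarrow> real).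
    convex_on UNIV l \<and> strictly_decreasing_to_0 l \<and> smooth_loss 2 l \<and>
    dataset d n x y \<and> linearly_separable d n x y \<and>
    \<not> (\<exists>w. limitin (Euclidean_space d)
              (\<lambda>(B :: real) i. constrained_minimizer l d n x y B i / B) w at_top)"
proof (intro exI conjI notI)
  show "convex_on UNIV osc_loss" "strictly_decreasing_to_0 osc_loss" "smooth_loss 2 osc_loss"
    by (rule osc_loss_convex osc_loss_decreasing osc_loss_smooth)+
  show "dataset 2 2 axis_data (\<lambda>_. 1)" "linearly_separable 2 2 axis_data (\<lambda>_. 1)"
    by (rule axis_dataset axis_separable)+
  let ?W = "constrained_minimizer osc_loss 2 2 axis_data (\<lambda>_. 1)"
  assume "\<exists>w. limitin (Euclidean_space 2) (\<lambda>B i. ?W B i / B) w at_top"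
  then obtain w where "((\<lambda>B. ?W B i / B) \<longlongrightarrow> w i) at_top" for i
    by (auto simp: Euclidean_space_def limitin_subtopology limitin_componentwise)
  then show False
    using osc_direction_diverges[of "\<lambda>B. ?W B 0" "\<lambda>B. ?W B 1"] osc_minimizer by blast
qed

end
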